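(* Let $\Gamma$ be a directed graph with vertex set $V$, and let $\mathcal{A}_\Gamma$ be the graph Laurent phenomenon algebra of $\Gamma$ with coefficient ring $R$. Then the cluster monomials of $\mathcal{A}_\Gamma$ form a linear basis of $\mathcal{A}_\Gamma$ over $R$; that is, the set of cluster monomials is linearly independent over $R$ and spans $\mathcal{A}_\Gamma$ as an $R$-module.
   Context: Graph. $\Gamma$ is a directed graph with vertex set $V$ and edge set $E$ (both $(u,v)$ and $(v,u)$ may be edges). Ring. The coefficient ring $R$ is a ring over $\mathbb{Z}$ containing elements $A_v$, one for each $v\in V$, which are algebraically independent (for example, $R$ could be $\mathbb{Z}[A_v : v\in V]$). $\mathcal{L}=R[X_v^{\pm1}: v\in V]$ is the Laurent polynomial ring over $R$ in independent variables $X_v$, $v\in V$. $Y$-elements. For $I\subset V$, a function on $I$ is a map $f:I\to V$ such that for every $v\in I$ either $f(v)=v$ or $(v,f(v))\in E$. It is acyclic if the directed graph with edges $(v,f(v))$, $v\in I$, has no directed cycles other than loops. Put $\tilde X_{(v,w)}=X_w$ if $w\ne v$ and $\tilde X_{(v,v)}=A_v$. Define $$Y_I=\sum_{f}\ \prod_{v\in I}\frac{\tilde X_{(v,f(v))}}{X_v}\in\mathcal{L},$$ the sum being over all acyclic functions $f$ on $I$ (so $Y_\varnothing=1$). Algebra. A set $I\subset V$ is strongly connected if for all $u,v\in I$ there is a directed path from $u$ to $v$ contained in $I$. The graph Laurent phenomenon algebra $\mathcal{A}_\Gamma$ is the $R$-subalgebra of $\mathcal{L}$ generated by all $X_v$ ($v\in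 V$) and all $Y_I$ with $I\subset V$ strongly connected. Nested multicollections. The strongly connected components of $U\subset V$ are the maximal strongly connected subsets of $U$; they partition $U$. A nested collection is a set $\mathcal{N}$ of subsets of $V$ (the empty set being disregarded) such that (1) for all $I,J\in\mathcal{N}$, $I\subset J$ or $J\subset I$ or $I\cap J=\varnothing$; and (2) for any $\mathcal{R}\subset\mathcal{N}$ whose distinct elements are pairwise disjoint, each $I\in\mathcal{R}$ is a strongly connected component of $\bigcup_{J\in\mathcal{R}}J$. A nested multicollection is a multiset of subsets of $V$ whose underlying set is a nested collection. Cluster monomials. The clusters of $\mathcal{A}_\Gamma$ are the sets $\{X_v:v\in U\}\cup\{Y_I:I\in\mathcal{N}\}$ where $U\subset V$ and $\mathcal{N}$ is a maximal nested collection on $V\setminus U$ (that is, of subsets of $V\setminus U$). A cluster monomial is a monomial in the elements of a single cluster; equivalently, an element $\prod_{v\in U}X_v\prod_{I\in\mathcal{N}}Y_I$ (finite products, taken with multiplicity), where $U$ is a multiset of vertices and $\mathcal{N}$ is a nested multicollection all of whose members are disjoint from the set of vertices occurring in $U$.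
   Formalization: The formal theorem takes V finite (so that every Y_I is defined) and R commutative, and adds that each A_v is a non-zero-divisor in R (automatic if R is a domain); without this the claim fails, e.g. one vertex, no edges, R = Z[a,t]/(at), A_1 = a, where t·Y_{1} = 0. *)

theory Defs
  imports Complex_Main "HOL-Library.Poly_Mapping" "HOL-Library.FuncSet" "HOL-Library.Multiset"
begin

text \<open>
  A Laurent monomial is a finitely supported exponent vector \<open>'v \<Rightarrow>\<^sub>0 int\<close>; the convolution
  product of \<open>Poly_Mapping\<close> makes the type below the Laurent polynomial ring over \<open>'r\<close> in
  variables indexed by all of \<open>'v\<close>. For a vertex set \<open>V\<close> it contains
  the Laurent polynomial ring in the variables \<open>X v\<close>, \<open>v \<in> V\<close>, as a subring, and everything below
  lives in that subring.
\<close>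

type_synonym ('v, 'r) laurent = "('v \<Rightarrow>\<^sub>0 int) \<Rightarrow>\<^sub>0 'r"

definition const :: "'r::comm_ring_1 \<Rightarrow> ('v, 'r) laurent" where
  "const c = Poly_Mapping.single 0 c"

definition X :: "'v \<Rightarrow> ('v, 'r::comm_ring_1) laurent" where
  "X v = Poly_Mapping.single (Poly_Mapping.single v 1) 1"

definition X_inv :: "'v \<Rightarrow> ('v, 'r::comm_ring_1) laurent" where
  "X_inv v = Poly_Mapping.single (Poly_Mapping.single v (- 1)) 1"

lemma X_mult_X_inv: "X v * X_inv v = 1"
  by (simp add: X_def X_inv_def mult_single flip: single_add)

definition scale :: "'r::comm_ring_1 \<Rightarrow> ('v, 'r) laurent \<Rightarrow> ('v, 'r) laurent" where
  "scale c p = const c * p"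

global_interpretation laurent: module "scale :: 'r::comm_ring_1 \<Rightarrow> ('v, 'r) laurent \<Rightarrow> ('v, 'r) laurent"
  by unfold_locales
    (simp_all add: scale_def const_def algebra_simps single_add mult_single flip: mult.assoc)

definition subalgebra :: "('v, 'r::comm_ring_1) laurent set \<Rightarrow> bool" where
  "subalgebra B \<longleftrightarrow> laurent.subspace B \<and> 1 \<in> B \<and> (\<forall>p\<in>B. \<forall>q\<in>B. p * q \<in> B)"

definition poly_eval :: "('v \<Rightarrow> 'r::comm_ring_1) \<Rightarrow> (('v \<Rightarrow>\<^sub>0 nat) \<Rightarrow>\<^sub>0 int) \<Rightarrow> 'r" where
  "poly_eval A p = (\<Sum>m\<in>Poly_Mapping.keys p. of_int (Poly_Mapping.lookup p m) *
     (\<Prod>v\<in>Poly_Mapping.keys m. A v ^ Poly_Mapping.lookup m v))"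

definition algebraically_independent_on :: "'v set \<Rightarrow> ('v \<Rightarrow> 'r::comm_ring_1) \<Rightarrow> bool" where
  "algebraically_independent_on V A \<longleftrightarrow>
     (\<forall>p. (\<forall>m\<in>Poly_Mapping.keys p. Poly_Mapping.keys m \<subseteq> V) \<and> poly_eval A p = 0 \<longrightarrow> p = 0)"

text \<open>
  A directed graph is given by its vertex set and its edge relation. A function on \<open>I\<close> is taken
  in the extensional function space, so that the sum defining \<open>Y E A I\<close> counts each one once.
\<close>

definition functions_on :: "('v \<times> 'v) set \<Rightarrow> 'v set \<Rightarrow> ('v \<Rightarrow> 'v) set" where
  "functions_on E I = (\<Pi>\<^sub>E v\<in>I. {w. w = v \<or> (v, w) \<in> E})"

definition acyclic_functions_on :: "('v \<times> 'v) set \<Rightarrow> 'v set \<Rightarrow> ('v \<Rightarrow> 'v) set" where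
  "acyclic_functions_on E I =
     {f \<in> functions_on E I. acyclic {(v, f v) | v. v \<in> I \<and> f v \<noteq> v}}"

definition X_tilde :: "('v \<Rightarrow> 'r::comm_ring_1) \<Rightarrow> 'v \<Rightarrow> 'v \<Rightarrow> ('v, 'r) laurent" where
  "X_tilde A v w = (if w = v then const (A v) else X w)"

definition Y :: "('v \<times> 'v) set \<Rightarrow> ('v \<Rightarrow> 'r::comm_ring_1) \<Rightarrow> 'v set \<Rightarrow> ('v, 'r) laurent" where
  "Y E A I = (\<Sum>f\<in>acyclic_functions_on E I. \<Prod>v\<in>I. X_tilde A v (f v) * X_inv v)"

definition strongly_connected :: "('v \<times> 'v) set \<Rightarrow> 'v set \<Rightarrow> bool" where
  "strongly_connected E I \<longleftrightarrow> (\<forall>u\<in>I. \<forall>v\<in>I. (u, v) \<in> (Restr E I)\<^sup>*)"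

definition graph_LP_algebra ::
  "'v set \<Rightarrow> ('v \<times> 'v) set \<Rightarrow> ('v \<Rightarrow> 'r::comm_ring_1) \<Rightarrow> ('v, 'r) laurent set" where
  "graph_LP_algebra V E A =
     subalgebra hull (X ` V \<union> Y E A ` {I. I \<subseteq> V \<and> strongly_connected E I})"

definition strong_components :: "('v \<times> 'v) set \<Rightarrow> 'v set \<Rightarrow> 'v set set" where
  "strong_components E U =
     {I. I \<noteq> {} \<and> I \<subseteq> U \<and> strongly_connected E I \<and>
         (\<forall>J. I \<subseteq> J \<and> J \<subseteq> U \<and> strongly_connected E J \<longrightarrow> J = I)}"

text \<open>
  The empty set, which is to be disregarded in nested collections, is excluded as a member;
  it would only contribute the factor \<open>Y E A {} = 1\<close>.
\<close>

definition nested_collection :: "('v \<times> 'v) set \<Rightarrow> 'v set \<Rightarrow> 'v set set \<Rightarrow> bool" where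
  "nested_collection E W N \<longleftrightarrow>
     N \<subseteq> Pow W - {{}} \<and>
     (\<forall>I\<in>N. \<forall>J\<in>N. I \<subseteq> J \<or> J \<subseteq> I \<or> I \<inter> J = {}) \<and>
     (\<forall>R\<subseteq>N. pairwise disjnt R \<longrightarrow> R \<subseteq> strong_components E (\<Union>R))"

definition maximal_nested_collection :: "('v \<times> 'v) set \<Rightarrow> 'v set \<Rightarrow> 'v set set \<Rightarrow> bool" where
  "maximal_nested_collection E W N \<longleftrightarrow>
     nested_collection E W N \<and> (\<forall>M. nested_collection E W M \<and> N \<subseteq> M \<longrightarrow> M = N)"

definition clusters ::
  "'v set \<Rightarrow> ('v \<times> 'v) set \<Rightarrow> ('v \<Rightarrow> 'r::comm_ring_1) \<Rightarrow> ('v, 'r) laurent set set" where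
  "clusters V E A =
     {X ` U \<union> Y E A ` N | U N. U \<subseteq> V \<and> maximal_nested_collection E (V - U) N}"

definition cluster_monomials ::
  "'v set \<Rightarrow> ('v \<times> 'v) set \<Rightarrow> ('v \<Rightarrow> 'r::comm_ring_1) \<Rightarrow> ('v, 'r) laurent set" where
  "cluster_monomials V E A = {\<Prod>\<^sub># M | M C. C \<in> clusters V E A \<and> set_mset M \<subseteq> C}"

end

theory Submission
  imports Defs
begin

text \<open>
  Expanding \<open>\<Prod>v\<in>I. Y {v}\<close> over all functions on \<open>I\<close> and cancelling the nontrivial cycles gives
  \<open>\<Prod>v\<in>I. Y {v} = (\<Sum>C\<subseteq>I. n C * Y (I - C))\<close>, where \<open>n C\<close> counts the fixed-point-free permutations of
  \<open>C\<close> along edges. Hence \<open>Y I\<close> is \<open>\<Prod>v\<in>I. Y {v}\<close> plus an integer combination of the products over proper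
  subsets of \<open>I\<close>. A nested multicollection is determined by the multiset of vertices that its members
  cover, and every multiset of vertices arises: its members are the strong components of the level
  sets. So cluster monomials are unitriangular over the monomials \<open>X\<^sup>a Y\<^sup>b\<close> with \<open>a\<close>, \<open>b\<close> of disjoint
  supports. These span, by \<open>X v * Y {v} = A v + (\<Sum>(v, w)\<in>E. X w)\<close> (loops excluded). For independence,
  the term of lowest total degree of the cluster monomial belonging to \<open>(a, b)\<close> is \<open>A\<^sup>b X\<^sup>a\<^sup>-\<^sup>b\<close>; the
  exponents \<open>a - b\<close> are pairwise distinct and the coefficients \<open>A\<^sup>b\<close> are not zero divisors.
\<close>

subsection \<open>Nested multicollections\<close>

lemma strongly_connected_Un:
  assumes "strongly_connected E I" "strongly_connected E J" "I \<inter> J \<noteq> {}"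
  shows "strongly_connected E (I \<union> J)"
proof -
  obtain x where x: "x \<in> I" "x \<in> J"
    using assms(3) by blast
  have "(Restr E I)\<^sup>* \<subseteq> (Restr E (I \<union> J))\<^sup>*" "(Restr E J)\<^sup>* \<subseteq> (Restr E (I \<union> J))\<^sup>*"
    by (auto intro!: rtrancl_mono)
  \<comment> \<open>Any two vertices of the union are joined by paths through the common vertex
    \<open>x\<close>.\<close>
  then have "(u, x) \<in> (Restr E (I \<union> J))\<^sup>* \<and> (x, u) \<in> (Restr E (I \<union> J))\<^sup>*" if "u \<in> I \<union> J" for u
    using that x assms(1,2) unfolding strongly_connected_def by blast
  then show ?thesis
    unfolding strongly_connected_def by (meson rtrancl_trans)
qed

text \<open>\<open>I \<union> K\<close> is strongly connected inside \<open>S\<close>, so maximality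
  of \<open>I\<close> forces it to be \<open>I\<close>.\<close>

lemma strong_components_absorb:
  assumes "I \<in> strong_components E S" "strongly_connected E K" "K \<subseteq> S" "K \<inter> I \<noteq> {}"
  shows "K \<subseteq> I"
proof -
  have "strongly_connected E (I \<union> K)"
    using assms strongly_connected_Un[of E I K] unfolding strong_components_def by blast
  then have "I \<union> K = I"
    using assms(1,3) unfolding strong_components_def by blast
  then show ?thesis by blast
qed

lemma strong_components_eqI:
  assumes "I \<in> strong_components E S" "J \<in> strong_components E S" "I \<inter> J \<noteq> {}"
  shows "I = J"
  using assms strong_components_absorb[of I E S J] strong_components_absorb[of J E S I]
  unfolding strong_components_def by blast

lemma strong_components_cover:
  assumes "finite S" "v \<in> S"
  shows "\<exists>I\<in>strong_components E S. v \<in> I"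
proof -
  let ?F = "{I. v \<in> I \<and> I \<subseteq> S \<and> strongly_connected E I}"
  have "finite ?F"
    by (rule finite_subset[of _ "Pow S"]) (use assms in auto)
  moreover have "{v} \<in> ?F"
    using assms by (auto simp: strongly_connected_def)
  \<comment> \<open>The component through \<open>v\<close> is found by enlarging \<open>{v}\<close>,
    which is strongly connected by the empty path.\<close>
  ultimately have "\<exists>M\<in>?F. {v} \<subseteq> M \<and> (\<forall>B\<in>?F. M \<subseteq> B \<longrightarrow> M = B)"
    by (rule finite_has_maximal2)
  then obtain M where M: "M \<in> ?F" "\<forall>B\<in>?F. M \<subseteq> B \<longrightarrow> M = B"
    by (elim bexE conjE)
  have "J = M" if "M \<subseteq> J" "J \<subseteq> S" "strongly_connected E J" for J
    using M that by auto
  then have "M \<in> strong_components E S"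
    using M(1) unfolding strong_components_def by auto
  then show ?thesis using M(1) by auto
qed

lemma Union_strong_components:
  assumes "finite S"
  shows "\<Union>(strong_components E S) = S"
  using strong_components_cover[OF assms] by (fastforce simp: strong_components_def)

section \<open>Elementary properties of nested collections\<close>

lemma nested_collection_member:
  assumes "nested_collection E W N" "I \<in> N"
  shows "I \<subseteq> W" "I \<noteq> {}"
proof -
  have "N \<subseteq> Pow W - {{}}"
    using assms(1) by (simp add: nested_collection_def)
  then show "I \<subseteq> W" "I \<noteq> {}"
    using assms(2) by auto
qed

lemma nested_collection_laminar:
  assumes "nested_collection E W N" "I \<in> N" "J \<in> N"
  shows "I \<subseteq> J \<or> J \<subseteq> I \<or> I \<inter> J = {}"
  using assms by (simp add: nested_collection_def)

lemma nested_collection_disjoint_components: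
  assumes "nested_collection E W N" "R \<subseteq> N" "pairwise disjnt R"
  shows "R \<subseteq> strong_components E (\<Union>R)"
  using assms by (simp add: nested_collection_def)

lemma nested_collection_subset:
  assumes "nested_collection E W N" "N' \<subseteq> N" "W \<subseteq> W'"
  shows "nested_collection E W' N'"
  unfolding nested_collection_def
proof (intro conjI ballI allI impI)
  show "N' \<subseteq> Pow W' - {{}}"
    using nested_collection_member[OF assms(1)] assms(2,3) by fast
  show "I \<subseteq> J \<or> J \<subseteq> I \<or> I \<inter> J = {}" if "I \<in> N'" "J \<in> N'" for I J
    using nested_collection_laminar[OF assms(1)] that assms(2) by (simp add: subset_iff)
  show "R \<subseteq> strong_components E (\<Union>R)" if "R \<subseteq> N'" "pairwise disjnt R" for R
    using nested_collection_disjoint_components[OF assms(1)] that assms(2) by simp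
qed

lemma nested_collection_strongly_connected:
  assumes "nested_collection E W N" "I \<in> N"
  shows "strongly_connected E I"
proof -
  have "{I} \<subseteq> strong_components E (\<Union>{I})"
    using assms by (intro nested_collection_disjoint_components) auto
  then show ?thesis
    by (simp add: strong_components_def)
qed

text \<open>Clusters are defined by maximal nested collections; this places an arbitrary nested
  collection inside a cluster.\<close>

lemma maximal_nested_collection_extends:
  assumes "finite W" "nested_collection E W N"
  obtains M where "maximal_nested_collection E W M" "N \<subseteq> M"
proof -
  let ?F = "{M. nested_collection E W M}"
  have "finite ?F"
    by (rule finite_subset[of _ "Pow (Pow W)"]) (use assms in \<open>auto simp: nested_collection_def\<close>)
  moreover have "N \<in> ?F"
    using assms(2) by simp
  ultimately have "\<exists>M\<in>?F. N \<subseteq> M \<and> (\<forall>B\<in>?F. M \<subseteq> B \<longrightarrow> M = B)"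
    by (rule finite_has_maximal2)
  then obtain M where "M \<in> ?F" "N \<subseteq> M" "\<forall>B\<in>?F. M \<subseteq> B \<longrightarrow> M = B"
    by (elim bexE conjE)
  then show thesis
    by (intro that[of M]) (auto simp: maximal_nested_collection_def)
qed

section \<open>Nested multicollections and their vertex multiplicities\<close>

definition content :: "'v set multiset \<Rightarrow> 'v multiset" where
  "content Q = (\<Sum>I\<in>#Q. mset_set I)"

lemma content_simps [simp]:
  "content {#} = {#}"
  "content (add_mset I Q) = mset_set I + content Q"
  "content (P + Q) = content P + content Q"
  by (simp_all add: content_def)

text \<open>Finiteness of the members matters because \<open>mset_set\<close> sends an infinite set
  to \<open>{#}\<close>.\<close>

lemma set_mset_content:
  assumes "\<And>I. I \<in># Q \<Longrightarrow> finite I"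
  shows "set_mset (content Q) = \<Union>(set_mset Q)"
  using assms by (induction Q) auto

lemma content_mset_set_disjoint:
  assumes "finite R" "\<And>I. I \<in> R \<Longrightarrow> finite I" "pairwise disjnt R"
  shows "content (mset_set R) = mset_set (\<Union>R)"
  using assms
proof (induction R)
  case (insert I R)
  have "pairwise disjnt R" and dis: "I \<inter> \<Union>R = {}"
    using insert.prems(2) insert.hyps by (auto simp: pairwise_insert) (auto simp: disjnt_def)
  moreover have "mset_set (I \<union> \<Union>R) = mset_set I + mset_set (\<Union>R)"
    by (rule mset_set_Union) (use insert dis in auto)
  ultimately show ?case
    using insert by simp
qed simp

text \<open>The inclusion-maximal members are pairwise disjoint by laminarity and have the same
  union as \<open>N\<close>, so the condition on disjoint subfamilies applies to them.\<close>

lemma nested_collection_maximal_member: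
  assumes "finite N" "nested_collection E V N" "I \<in> N" "\<forall>J\<in>N. I \<subseteq> J \<longrightarrow> I = J"
  shows "I \<in> strong_components E (\<Union>N)"
proof -
  define R where "R = {I \<in> N. \<forall>J\<in>N. I \<subseteq> J \<longrightarrow> I = J}"
  have RN: "R \<subseteq> N"
    unfolding R_def by blast
  have "\<exists>K\<in>R. J \<subseteq> K" if J: "J \<in> N" for J
  proof -
    from finite_has_maximal2[OF assms(1) J] obtain K where
      "K \<in> N" "J \<subseteq> K" "\<forall>L\<in>N. K \<subseteq> L \<longrightarrow> K = L"
      by (elim bexE conjE)
    then show ?thesis unfolding R_def by auto
  qed
  then have "\<Union>R = \<Union>N"
    using RN by blast
  moreover have "disjnt J K" if "J \<in> R" "K \<in> R" "J \<noteq> K" for J K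
    using that nested_collection_laminar[OF assms(2), of J K] unfolding R_def disjnt_def by auto
  then have "pairwise disjnt R"
    unfolding pairwise_def by blast
  then have "R \<subseteq> strong_components E (\<Union>R)"
    by (rule nested_collection_disjoint_components[OF assms(2) RN])
  moreover have "I \<in> R"
    using assms(3,4) unfolding R_def by auto
  ultimately show ?thesis by auto
qed

text \<open>The union of the members is the support of the content, and a maximal member is a strong
  component of that union. Hence the two multicollections share a maximal member; removing one copy
  of it from each leaves equal contents, and induction on the size applies.\<close>

lemma nested_multicollection_eqI:
  assumes "finite V" "nested_collection E V (set_mset P)" "nested_collection E V (set_mset Q)"
    "content P = content Q"
  shows "P = Q"
  using assms(2-4)
proof (induction "size P" arbitrary: P Q)
  case 0
  have "content Q = {#}" using 0 by simp
  moreover have "content Q \<noteq> {#}" if "I \<in># Q" for I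
  proof -
    have "I \<subseteq> V" "I \<noteq> {}"
      using nested_collection_member[OF 0(3) that] by auto
    then have "mset_set I \<noteq> {#}"
      using assms(1) finite_subset[of I V] by (simp add: mset_set_empty_iff)
    then show ?thesis
      using multi_member_split[OF that] by auto
  qed
  ultimately have "Q = {#}"
    by (meson multiset_nonemptyE)
  then show ?case
    using 0(1) by simp
next
  case (Suc n)
  have fin: "finite I" if "I \<in># P \<or> I \<in># Q" for I
    using that nested_collection_member(1)[OF Suc.prems(1)] nested_collection_member(1)[OF Suc.prems(2)]
      finite_subset[OF _ assms(1)] by auto
  have S: "\<Union>(set_mset P) = \<Union>(set_mset Q)"
    using set_mset_content[of P] set_mset_content[of Q] fin by (simp flip: Suc.prems(3))
  obtain I0 where "I0 \<in># P"
    using Suc.hyps(2) by (metis size_eq_Suc_imp_elem)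
  from finite_has_maximal2[OF finite_set_mset this]
  obtain I where I: "I \<in># P" "\<forall>J\<in>#P. I \<subseteq> J \<longrightarrow> I = J"
    by (elim bexE conjE)
  then have comp: "I \<in> strong_components E (\<Union>(set_mset P))"
    using nested_collection_maximal_member[OF finite_set_mset Suc.prems(1)] by simp
  then obtain v where v: "v \<in> I"
    unfolding strong_components_def by blast
  \<comment> \<open>A maximal member of \<open>Q\<close> is chosen through the same vertex
    \<open>v\<close> as \<open>I\<close>. Both are strong components of the common union and meet in
    \<open>v\<close>, so they coincide.\<close>
  then obtain J0 where J0: "J0 \<in># Q" "v \<in> J0"
    using S I(1) by (metis UnionE UnionI)
  from finite_has_maximal2[OF finite_set_mset J0(1)]
  obtain J where J: "J \<in># Q" "J0 \<subseteq> J" "\<forall>K\<in>#Q. J \<subseteq> K \<longrightarrow> J = K"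
    by (elim bexE conjE)
  then have "J \<in> strong_components E (\<Union>(set_mset P))"
    using nested_collection_maximal_member[OF finite_set_mset Suc.prems(2)] S by simp
  then have "I = J"
    using strong_components_eqI[OF comp] v J(2) J0(2) by auto
  then obtain P' Q' where PQ: "P = add_mset I P'" "Q = add_mset I Q'"
    using I(1) J(1) by (metis multi_member_split)
  have "P' = Q'"
  proof (rule Suc.hyps(1))
    show "nested_collection E V (set_mset P')" "nested_collection E V (set_mset Q')"
      using PQ by (auto intro: nested_collection_subset[OF Suc.prems(1)] nested_collection_subset[OF Suc.prems(2)])
  qed (use Suc.hyps(2) Suc.prems(3) PQ in auto)
  then show ?case using PQ by simp
qed

text \<open>Every member is strongly connected, so a component of \<open>S\<close> that meets it
  contains it. This gives laminarity, and it is also what keeps components in a disjoint subfamily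
  from merging with other members.\<close>

lemma nested_collection_Un_strong_components:
  assumes "nested_collection E S N"
  shows "nested_collection E S (N \<union> strong_components E S)"
  unfolding nested_collection_def
proof (intro conjI allI impI ballI)
  let ?C = "strong_components E S"
  show "N \<union> ?C \<subseteq> Pow S - {{}}"
    using nested_collection_member[OF assms] by (auto simp: strong_components_def)
  have sub: "J \<subseteq> I \<or> I \<inter> J = {}" if "I \<in> ?C" "J \<in> N \<union> ?C" for I J
  proof -
    have "strongly_connected E J" "J \<subseteq> S"
      using that(2) nested_collection_member(1)[OF assms] nested_collection_strongly_connected[OF assms]
      by (auto simp: strong_components_def)
    then show ?thesis
      using strong_components_absorb[OF that(1)] by blast
  qed
  show "I \<subseteq> J \<or> J \<subseteq> I \<or> I \<inter> J = {}" if "I \<in> N \<union> ?C" "J \<in> N \<union> ?C" for I J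
    using sub[of I J] sub[of J I] that nested_collection_laminar[OF assms, of I J] by blast
  fix R assume R: "R \<subseteq> N \<union> ?C" "pairwise disjnt R"
  have RS: "\<Union>R \<subseteq> S"
    using R(1) nested_collection_member(1)[OF assms] unfolding strong_components_def by blast
  show "R \<subseteq> strong_components E (\<Union>R)"
  proof
    fix I assume I: "I \<in> R"
    have "I \<noteq> {}" "strongly_connected E I"
      using I R(1) nested_collection_member(2)[OF assms] nested_collection_strongly_connected[OF assms]
      unfolding strong_components_def by blast+
    \<comment> \<open>Either \<open>K\<close> meets a member of \<open>R\<close> that is a component
      of \<open>S\<close>, which then absorbs \<open>K\<close> and equals \<open>I\<close> by
      disjointness, or \<open>K\<close> is covered by members from \<open>N\<close> alone, where the
      nestedness of \<open>N\<close> decides.\<close>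
    moreover have "K = I" if K: "I \<subseteq> K" "K \<subseteq> \<Union>R" "strongly_connected E K" for K
    proof (cases "\<exists>J \<in> R \<inter> ?C. K \<inter> J \<noteq> {}")
      case True
      then obtain J where J: "J \<in> R" "J \<in> ?C" "K \<inter> J \<noteq> {}" by blast
      then have "K \<subseteq> J"
        using strong_components_absorb[OF J(2) K(3)] K(2) RS by blast
      moreover have "I = J"
        using R(2) I J(1) \<open>I \<noteq> {}\<close> \<open>K \<subseteq> J\<close> K(1) unfolding pairwise_def disjnt_def by blast
      ultimately show ?thesis using K(1) by blast
    next
      case False
      have "R \<inter> N \<subseteq> strong_components E (\<Union>(R \<inter> N))"
        using pairwise_subset[OF R(2), of "R \<inter> N"]
        by (intro nested_collection_disjoint_components[OF assms]) auto
      moreover have N: "J \<in> R \<inter> N" if "J \<in> R" "K \<inter> J \<noteq> {}" for J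
        using False R(1) that by auto
      moreover have "K \<inter> I \<noteq> {}"
        using K(1) \<open>I \<noteq> {}\<close> by auto
      ultimately have "I \<in> strong_components E (\<Union>(R \<inter> N))"
        using I by (meson subsetD)
      moreover have "K \<subseteq> \<Union>(R \<inter> N)"
      proof
        fix x assume "x \<in> K"
        with K(2) obtain J where "J \<in> R" "x \<in> J" by auto
        then show "x \<in> \<Union>(R \<inter> N)"
          using N[of J] \<open>x \<in> K\<close> by auto
      qed
      ultimately show ?thesis
        using K(1,3) by (simp add: strong_components_def)
    qed
    ultimately show "I \<in> strong_components E (\<Union>R)"
      using I by (simp add: strong_components_def Union_upper)
  qed
qed

text \<open>The multicollection is built in layers: the strong components of the support of
  \<open>b\<close> cover each vertex of the support once, and the induction treats \<open>b\<close>
  with one copy of each such vertex removed.\<close>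

lemma nested_multicollection_exists:
  "\<exists>Q. nested_collection E (set_mset b) (set_mset Q) \<and> content Q = b"
proof (induction "size b" arbitrary: b rule: less_induct)
  case less
  show ?case
  proof (cases "b = {#}")
    case True
    then show ?thesis
      by (intro exI[of _ "{#}"]) (simp add: nested_collection_def subset_empty)
  next
    case False
    let ?S = "set_mset b" and ?C = "strong_components E (set_mset b)"
    have le: "mset_set ?S \<subseteq># b"
      by (simp add: mset_set_set_mset_msubset)
    have finC: "finite ?C"
      by (rule finite_subset[of _ "Pow ?S"]) (auto simp: strong_components_def)
    have "size (b - mset_set ?S) < size b"
      using False le by (simp add: size_Diff_submset nonempty_has_size card_gt_0_iff)
    from less[OF this] obtain Q where Q: "nested_collection E (set_mset (b - mset_set ?S)) (set_mset Q)"
      "content Q = b - mset_set ?S"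
      by (elim exE conjE)
    have "nested_collection E ?S (set_mset Q)"
      by (rule nested_collection_subset[OF Q(1) subset_refl]) (auto dest: in_diffD)
    then have "nested_collection E ?S (set_mset (Q + mset_set ?C))"
      using nested_collection_Un_strong_components finC by simp
    moreover have "content (mset_set ?C) = mset_set ?S"
    proof -
      have "content (mset_set ?C) = mset_set (\<Union>?C)"
      proof (rule content_mset_set_disjoint[OF finC])
        show "finite I" if "I \<in> ?C" for I
          using that by (auto simp: strong_components_def intro: finite_subset[of I ?S])
        show "pairwise disjnt ?C"
          by (intro pairwiseI) (metis strong_components_eqI disjnt_def)
      qed
      then show ?thesis
        by (simp add: Union_strong_components)
    qed
    then have "content (Q + mset_set ?C) = b"
      using Q(2) le by simp
    ultimately show ?thesis
      by (intro exI[of _ "Q + mset_set ?C"] conjI)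
  qed
qed

subsection \<open>Cycles of functions\<close>

definition nonloop_arcs :: "('v \<Rightarrow> 'v) \<Rightarrow> 'v set \<Rightarrow> ('v \<times> 'v) set" where
  "nonloop_arcs f I = {(v, f v) | v. v \<in> I \<and> f v \<noteq> v}"

definition cyclic_part :: "('v \<Rightarrow> 'v) \<Rightarrow> 'v set \<Rightarrow> 'v set" where
  "cyclic_part f I = {v. (v, v) \<in> (nonloop_arcs f I)\<^sup>+}"

text \<open>For finite \<open>C\<close> these are permutations, since a surjection of a finite set
  onto itself is injective. They correspond to covers of \<open>C\<close> by disjoint directed
  cycles of length at least 2, the possible restrictions of a function to its cyclic part.\<close>

definition derangements_on :: "('v \<times> 'v) set \<Rightarrow> 'v set \<Rightarrow> ('v \<Rightarrow> 'v) set" where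
  "derangements_on E C = {g \<in> functions_on E C. g ` C = C \<and> (\<forall>v\<in>C. g v \<noteq> v)}"

lemma acyclic_functions_on_altdef:
  "acyclic_functions_on E I = {f \<in> functions_on E I. acyclic (nonloop_arcs f I)}"
  by (simp add: acyclic_functions_on_def nonloop_arcs_def)

lemma nonloop_arcs_iff: "(u, w) \<in> nonloop_arcs f I \<longleftrightarrow> u \<in> I \<and> w = f u \<and> f u \<noteq> u"
  by (auto simp: nonloop_arcs_def)

lemma cyclic_part_subset: "cyclic_part f I \<subseteq> I"
  by (auto simp: cyclic_part_def nonloop_arcs_iff dest: tranclD)

lemma cyclic_part_not_fixed: "v \<in> cyclic_part f I \<Longrightarrow> f v \<noteq> v"
  by (auto simp: cyclic_part_def nonloop_arcs_iff dest: tranclD)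

text \<open>The successor and the predecessor of a vertex on a cycle lie on that same cycle.\<close>

lemma image_cyclic_part: "f ` cyclic_part f I = cyclic_part f I"
proof
  show "f ` cyclic_part f I \<subseteq> cyclic_part f I"
  proof clarify
    fix v assume "v \<in> cyclic_part f I"
    then have "(v, v) \<in> (nonloop_arcs f I)\<^sup>+"
      by (simp add: cyclic_part_def)
    then obtain u where u: "(v, u) \<in> nonloop_arcs f I" "(u, v) \<in> (nonloop_arcs f I)\<^sup>*"
      by (blast dest: tranclD)
    then have "(u, u) \<in> (nonloop_arcs f I)\<^sup>+"
      by (meson rtrancl_into_trancl1)
    then show "f v \<in> cyclic_part f I"
      using u(1) by (simp add: cyclic_part_def nonloop_arcs_iff)
  qed
  show "cyclic_part f I \<subseteq> f ` cyclic_part f I"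
  proof
    fix v assume "v \<in> cyclic_part f I"
    then have "(v, v) \<in> (nonloop_arcs f I)\<^sup>+"
      by (simp add: cyclic_part_def)
    then obtain u where u: "(v, u) \<in> (nonloop_arcs f I)\<^sup>*" "(u, v) \<in> nonloop_arcs f I"
      by (blast dest: tranclD2)
    then have "(u, u) \<in> (nonloop_arcs f I)\<^sup>+"
      by (meson rtrancl_into_trancl2)
    then show "v \<in> f ` cyclic_part f I"
      using u(2) by (auto simp: cyclic_part_def nonloop_arcs_iff)
  qed
qed

lemma nonloop_arcs_mono: "I \<subseteq> J \<Longrightarrow> nonloop_arcs f I \<subseteq> nonloop_arcs f J"
  by (auto simp: nonloop_arcs_def)

lemma nonloop_arcs_cong: "(\<And>v. v \<in> I \<Longrightarrow> f v = g v) \<Longrightarrow> nonloop_arcs f I = nonloop_arcs g I"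
  by (auto simp: nonloop_arcs_def)

text \<open>A cycle off the cyclic part would still be a cycle of \<open>f\<close> on
  \<open>I\<close>, so its vertices would belong to the cyclic part.\<close>

lemma acyclic_off_cyclic_part: "acyclic (nonloop_arcs f (I - cyclic_part f I))"
  unfolding acyclic_def
proof (intro allI notI)
  fix v assume v: "(v, v) \<in> (nonloop_arcs f (I - cyclic_part f I))\<^sup>+"
  then have "v \<in> I - cyclic_part f I"
    by (auto simp: nonloop_arcs_iff dest: tranclD)
  moreover have "(v, v) \<in> (nonloop_arcs f I)\<^sup>+"
    using v nonloop_arcs_mono[of "I - cyclic_part f I" I f] by (meson Diff_subset trancl_mono)
  ultimately show False
    by (simp add: cyclic_part_def)
qed

text \<open>This recovers \<open>C\<close> from a function glued from a derangement of
  \<open>C\<close> and an acyclic function on \<open>I - C\<close>.\<close>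

lemma cyclic_part_derangement:
  assumes "finite C" "f ` C = C" "\<And>v. v \<in> C \<Longrightarrow> f v \<noteq> v" "C \<subseteq> I"
    "acyclic (nonloop_arcs f (I - C))"
  shows "cyclic_part f I = C"
proof
  \<comment> \<open>Since \<open>f\<close> maps \<open>C\<close> to itself, a path that enters
    \<open>C\<close> stays there; a path ending outside \<open>C\<close> therefore runs through
    \<open>I - C\<close> only.\<close>
  have leave: "w \<in> C \<or> (u, w) \<in> (nonloop_arcs f (I - C))\<^sup>+" if "(u, w) \<in> (nonloop_arcs f I)\<^sup>+" for u w
    using that
  proof induction
    case (base w)
    then show ?case
      using assms(2) by (cases "u \<in> C") (auto simp: nonloop_arcs_iff intro!: r_into_trancl)
  next
    case (step w x)
    then show ?case
      using assms(2)
      by (cases "w \<in> C") (auto simp: nonloop_arcs_iff intro: trancl_into_trancl)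
  qed
  show "cyclic_part f I \<subseteq> C"
    using leave assms(5) unfolding cyclic_part_def acyclic_def by blast
  show "C \<subseteq> cyclic_part f I"
  proof
    fix v assume v: "v \<in> C"
    let ?r = "nonloop_arcs f C"
    \<comment> \<open>\<open>?S\<close> and \<open>?T\<close> hold the vertices reached from
      \<open>v\<close> in at least zero and at least one steps. As \<open>f\<close> maps
      \<open>?S\<close> injectively into \<open>?T\<close>, the two sets are equal, so
      \<open>v\<close> returns to itself.\<close>
    let ?S = "?r\<^sup>* `` {v}" and ?T = "?r\<^sup>+ `` {v}"
    have SC: "?S \<subseteq> C"
    proof clarify
      fix w assume "(v, w) \<in> ?r\<^sup>*"
      then show "w \<in> C"
        using v assms(2) by induction (auto simp: nonloop_arcs_iff)
    qed
    have "f ` ?S \<subseteq> ?T"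
    proof clarify
      fix w assume w: "(v, w) \<in> ?r\<^sup>*"
      then have "(w, f w) \<in> ?r"
        using SC assms(3) by (auto simp: nonloop_arcs_iff)
      then show "(v, f w) \<in> ?r\<^sup>+"
        using w by (rule rtrancl_into_trancl1[rotated])
    qed
    moreover have TS: "?T \<subseteq> ?S"
      by (auto intro: trancl_into_rtrancl)
    moreover have finS: "finite ?S"
      using SC assms(1) by (rule finite_subset)
    moreover have "inj_on f ?S"
      using eq_card_imp_inj_on[OF assms(1), of f] assms(2) SC by (simp add: inj_on_subset)
    ultimately have "card ?S \<le> card ?T"
      by (metis card_image card_mono finite_subset)
    then have "?T = ?S"
      using card_seteq[OF finS TS] by simp
    then have "(v, v) \<in> ?r\<^sup>+" by blast
    then show "v \<in> cyclic_part f I"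
      using nonloop_arcs_mono[OF assms(4), of f] by (auto simp: cyclic_part_def intro: trancl_mono)
  qed
qed

lemma functions_on_restrict:
  "f \<in> functions_on E I \<Longrightarrow> J \<subseteq> I \<Longrightarrow> restrict f J \<in> functions_on E J"
  by (fastforce simp: functions_on_def PiE_iff)

text \<open>The inverse glues the two functions along \<open>C\<close>; \<open>restrict\<close>
  keeps all of them in the extensional function space, so that each is counted once.\<close>

lemma bij_betw_split_cyclic_part:
  assumes "finite I"
  shows "bij_betw (\<lambda>f. (cyclic_part f I, restrict f (cyclic_part f I), restrict f (I - cyclic_part f I)))
     (functions_on E I)
     (SIGMA C:Pow I. derangements_on E C \<times> acyclic_functions_on E (I - C))"
    (is "bij_betw ?split _ ?T")
proof (rule bij_betw_byWitness[where f' = "\<lambda>(C, g, h). restrict (\<lambda>v. if v \<in> C then g v else h v) I"])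
  let ?glue = "\<lambda>(C, g, h). restrict (\<lambda>v. if v \<in> C then g v else h v) I"
  show "\<forall>f\<in>functions_on E I. ?glue (?split f) = f"
    by (auto simp: functions_on_def PiE_iff extensional_def)
  show "?split ` functions_on E I \<subseteq> ?T"
  proof clarsimp
    fix f assume f: "f \<in> functions_on E I"
    let ?C = "cyclic_part f I"
    have "restrict f ?C \<in> derangements_on E ?C"
      using functions_on_restrict[OF f cyclic_part_subset] image_cyclic_part[of f I]
        cyclic_part_not_fixed[of _ f I] by (auto simp: derangements_on_def)
    moreover have "restrict f (I - ?C) \<in> acyclic_functions_on E (I - ?C)"
      using functions_on_restrict[OF f, of "I - ?C"] acyclic_off_cyclic_part[of f I]
        nonloop_arcs_cong[of "I - ?C" "restrict f (I - ?C)" f]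
      by (simp add: acyclic_functions_on_altdef)
    ultimately show "?C \<subseteq> I \<and> restrict f ?C \<in> derangements_on E ?C \<and>
        restrict f (I - ?C) \<in> acyclic_functions_on E (I - ?C)"
      by (intro conjI cyclic_part_subset)
  qed
  have *: "?split (?glue (C, g, h)) = (C, g, h) \<and> ?glue (C, g, h) \<in> functions_on E I"
    if C: "C \<subseteq> I" and g: "g \<in> derangements_on E C" and h: "h \<in> acyclic_functions_on E (I - C)" for C g h
  proof -
    let ?f = "?glue (C, g, h)"
    have fC: "?f v = g v" if "v \<in> C" for v using that C by auto
    have fD: "?f v = h v" if "v \<in> I - C" for v using that by auto
    have "?f ` C = C"
      using fC g by (simp add: derangements_on_def)
    moreover have "?f v \<noteq> v" if "v \<in> C" for v
      using fC[OF that] g that by (simp add: derangements_on_def)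
    moreover have "acyclic (nonloop_arcs ?f (I - C))"
      using nonloop_arcs_cong[of "I - C" ?f h, OF fD] h by (simp add: acyclic_functions_on_altdef)
    ultimately have cp: "cyclic_part ?f I = C"
      using finite_subset[OF C assms] C by (intro cyclic_part_derangement)
    have "g \<in> functions_on E C" "h \<in> functions_on E (I - C)"
      using g h by (auto simp: derangements_on_def acyclic_functions_on_def)
    then have "?f \<in> functions_on E I" "restrict ?f C = g" "restrict ?f (I - C) = h"
      using C by (auto simp: functions_on_def PiE_iff extensional_def fun_eq_iff)
    then show ?thesis
      using cp by (simp only:)
  qed
  have "?split (?glue t) = t \<and> ?glue t \<in> functions_on E I" if "t \<in> ?T" for t
  proof (cases t)
    case (fields C g h)
    show ?thesis
      unfolding fields by (rule *) (use that fields in auto)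
  qed
  then show "\<forall>t\<in>?T. ?split (?glue t) = t" and "?glue ` ?T \<subseteq> functions_on E I"
    by (intro ballI image_subsetI; simp only:)+
qed

section \<open>Expansion of products of the elements \<open>Y E A {v}\<close>\<close>

lemma finite_functions_on_choices:
  assumes "finite E"
  shows "finite {w. w = v \<or> (v, w) \<in> E}"
  by (rule finite_subset[of _ "insert v (snd ` E)"]) (use assms in force)+

lemma finite_functions_on:
  assumes "finite E" "finite I"
  shows "finite (functions_on E I)"
  using assms unfolding functions_on_def by (intro finite_PiE finite_functions_on_choices)

lemma Y_singleton_sum:
  assumes "finite E"
  shows "Y E A {v} = (\<Sum>w | w = v \<or> (v, w) \<in> E. X_tilde A v w * X_inv v)"
proof -
  have fin: "finite {w. w = v \<or> (v, w) \<in> E}" for v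
    by (rule finite_functions_on_choices) (use assms in simp)
  \<comment> \<open>A non-loop arc on \<open>{v}\<close> leaves \<open>{v}\<close> and cannot be
    continued, so every function on a single vertex is acyclic.\<close>
  have "acyclic (nonloop_arcs f {v})" for f
  proof -
    have "w \<noteq> v \<and> u = v" if "(u, w) \<in> (nonloop_arcs f {v})\<^sup>+" for u w
      using that by induction (auto simp: nonloop_arcs_iff)
    then show ?thesis
      unfolding acyclic_def by blast
  qed
  then have "acyclic_functions_on E {v} = functions_on E {v}"
    by (simp add: acyclic_functions_on_altdef)
  then show ?thesis
    using prod_sum_PiE[of "{v}" "\<lambda>v. {w. w = v \<or> (v, w) \<in> E}" "\<lambda>v w. X_tilde A v w * X_inv v"] fin
    by (simp add: Y_def functions_on_def)
qed

text \<open>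
  Every function on \<open>I\<close> splits into its nontrivial cycles, over which the factors \<open>X (f v) / X v\<close>
  cancel, and an acyclic function on the remaining vertices.
\<close>

lemma prod_Y_singletons:
  fixes A :: "'v \<Rightarrow> 'r::comm_ring_1"
  assumes "finite E" "finite I"
  shows "(\<Prod>v\<in>I. Y E A {v}) = (\<Sum>C\<in>Pow I. of_nat (card (derangements_on E C)) * Y E A (I - C))"
proof -
  let ?t = "\<lambda>v w. X_tilde A v w * X_inv v"
  let ?T = "\<lambda>C. derangements_on E C \<times> acyclic_functions_on E (I - C)"
  have fin: "finite {w. w = v \<or> (v, w) \<in> E}" for v
    by (rule finite_functions_on_choices) (use assms in simp)
  have finD: "finite (derangements_on E C)" "finite (acyclic_functions_on E (I - C))" if "C \<subseteq> I" for C
    using finite_functions_on[OF assms(1)] finite_subset[OF that assms(2)] assms(2)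
    by (simp_all add: derangements_on_def acyclic_functions_on_def)
  have der: "(\<Prod>v\<in>C. ?t v (g v)) = 1" if "C \<subseteq> I" "g \<in> derangements_on E C" for C g
  proof -
    have "finite C" using that assms finite_subset by blast
    moreover have g: "g ` C = C" "\<And>v. v \<in> C \<Longrightarrow> g v \<noteq> v"
      using that by (auto simp: derangements_on_def)
    ultimately have "inj_on g C"
      by (simp add: eq_card_imp_inj_on)
    have "(\<Prod>v\<in>C. ?t v (g v)) = (\<Prod>v\<in>C. X (g v)) * (\<Prod>v\<in>C. X_inv v)"
      using g(2) by (simp add: X_tilde_def prod.distrib)
    also have "(\<Prod>v\<in>C. X (g v)) = (\<Prod>v\<in>C. X v :: ('v, 'r) laurent)"
      using prod.reindex[OF \<open>inj_on g C\<close>, of "X :: 'v \<Rightarrow> ('v, 'r) laurent"] g(1) by (simp add: o_def)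
    also have "\<dots> * (\<Prod>v\<in>C. X_inv v) = 1"
      by (simp add: X_mult_X_inv flip: prod.distrib)
    finally show ?thesis .
  qed
  have "(\<Prod>v\<in>I. Y E A {v}) = (\<Sum>f\<in>functions_on E I. \<Prod>v\<in>I. ?t v (f v))"
    using assms fin by (simp add: Y_singleton_sum prod_sum_PiE functions_on_def)
  also have "\<dots> = (\<Sum>f\<in>functions_on E I. (\<lambda>(C, g, h). \<Prod>v\<in>I - C. ?t v (h v))
      (cyclic_part f I, restrict f (cyclic_part f I), restrict f (I - cyclic_part f I)))"
  proof (rule sum.cong[OF refl])
    fix f assume f: "f \<in> functions_on E I"
    let ?C = "cyclic_part f I"
    have "restrict f ?C \<in> derangements_on E ?C"
      using bij_betw_imp_surj_on[OF bij_betw_split_cyclic_part[OF assms(2), of E]] f by blast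
    then have "(\<Prod>v\<in>?C. ?t v (f v)) = 1"
      using der[OF cyclic_part_subset] by fastforce
    then show "(\<Prod>v\<in>I. ?t v (f v)) = (\<lambda>(C, g, h). \<Prod>v\<in>I - C. ?t v (h v))
        (?C, restrict f ?C, restrict f (I - ?C))"
      using prod.subset_diff[OF cyclic_part_subset assms(2), of "\<lambda>v. ?t v (f v)" f] by simp
  qed
  also have "\<dots> = (\<Sum>(C, g, h)\<in>(SIGMA C:Pow I. ?T C). \<Prod>v\<in>I - C. ?t v (h v))"
    by (rule sum.reindex_bij_betw[OF bij_betw_split_cyclic_part[OF assms(2)]])
  also have "\<dots> = (\<Sum>C\<in>Pow I. \<Sum>(g, h)\<in>?T C. \<Prod>v\<in>I - C. ?t v (h v))"
    using finD assms(2) by (subst sum.Sigma) (auto simp: case_prod_beta)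
  \<comment> \<open>The summand does not depend on \<open>g\<close>, so summing over
    \<open>g\<close> produces the number of derangements of \<open>C\<close>.\<close>
  also have "\<dots> = (\<Sum>C\<in>Pow I. of_nat (card (derangements_on E C)) * Y E A (I - C))"
    using finD by (intro sum.cong refl) (simp add: Y_def flip: sum.cartesian_product)
  finally show ?thesis .
qed

subsection \<open>Unitriangularity and spanning\<close>

lemma scale_mult_left: "scale c p * q = scale c (p * q)"
  by (simp add: scale_def mult.assoc)

lemma scale_mult_right: "p * scale c q = scale c (p * q)"
  by (simp add: scale_def mult.left_commute)

text \<open>By bilinearity it suffices to multiply spanning elements.\<close>

lemma span_mult:
  assumes "p \<in> laurent.span S" "q \<in> laurent.span T"
    and "\<And>s t. s \<in> S \<Longrightarrow> t \<in> T \<Longrightarrow> s * t \<in> laurent.span U"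
  shows "p * q \<in> laurent.span U"
proof -
  have "s * q \<in> laurent.span U" if "s \<in> S" for s
    using assms(2)
  proof (induction rule: laurent.span_induct_alt)
    case (step c x y)
    then show ?case
      using assms(3)[OF that]
      by (simp add: distrib_left scale_mult_right laurent.span_add laurent.span_scale)
  qed (simp add: laurent.span_zero)
  with assms(1) show ?thesis
  proof (induction rule: laurent.span_induct_alt)
    case (step c x y)
    then show ?case
      by (simp add: distrib_right scale_mult_left laurent.span_add laurent.span_scale)
  qed (simp add: laurent.span_zero)
qed

lemma span_of_nat_mult:
  assumes "p \<in> laurent.span S"
  shows "of_nat n * p \<in> laurent.span S"
  by (induction n) (use assms in \<open>auto simp: distrib_right laurent.span_zero laurent.span_add\<close>)

section \<open>Monomials in the \<open>X v\<close> and the \<open>Y E A {v}\<close>, and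
  triangularity\<close>

definition X_mon :: "'v multiset \<Rightarrow> ('v, 'r::comm_ring_1) laurent" where
  "X_mon a = (\<Prod>v\<in>#a. X v)"

text \<open>Exponent vectors are encoded as multisets, so that \<open>\<subset>#\<close> is the
  order for triangularity.\<close>

definition Y_mon :: "('v \<times> 'v) set \<Rightarrow> ('v \<Rightarrow> 'r::comm_ring_1) \<Rightarrow> 'v multiset \<Rightarrow> ('v, 'r) laurent" where
  "Y_mon E A b = (\<Prod>v\<in>#b. Y E A {v})"

lemma X_mon_simps [simp]:
  "X_mon {#} = 1" "X_mon (add_mset v a) = X v * X_mon a" "X_mon (a + a') = X_mon a * X_mon a'"
  by (simp_all add: X_mon_def)

lemma Y_mon_simps [simp]:
  "Y_mon E A {#} = 1" "Y_mon E A (add_mset v b) = Y E A {v} * Y_mon E A b"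
  "Y_mon E A (b + b') = Y_mon E A b * Y_mon E A b'"
  by (simp_all add: Y_mon_def)

lemma Y_mon_mset_set: "Y_mon E A (mset_set I) = (\<Prod>v\<in>I. Y E A {v})"
  by (simp add: Y_mon_def prod_unfold_prod_mset)

text \<open>There is exactly one element, so the term \<open>C = {}\<close> of
  \<open>prod_Y_singletons\<close> is \<open>Y E A I\<close> with coefficient 1; this is the unit on
  the diagonal.\<close>

lemma derangements_on_empty: "derangements_on E {} = {\<lambda>_. undefined}"
  by (auto simp: derangements_on_def functions_on_def)

text \<open>Solve \<open>prod_Y_singletons\<close> for its term \<open>C = {}\<close>. The remaining
  terms involve \<open>Y E A (I - C)\<close> with \<open>I - C\<close> a proper subset of
  \<open>I\<close>, and induction expresses these through smaller monomials.\<close>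

lemma Y_unitriangular:
  assumes "finite E" "finite I"
  shows "Y E A I - Y_mon E A (mset_set I) \<in> laurent.span (Y_mon E A ` {b. b \<subset># mset_set I})"
  using assms(2)
proof (induction I rule: finite_psubset_induct)
  case (psubset I)
  let ?S = "\<lambda>I. laurent.span (Y_mon E A ` {b. b \<subset># mset_set I})"
  let ?n = "\<lambda>C. of_nat (card (derangements_on E C))"
  have "(\<Prod>v\<in>I. Y E A {v}) = Y E A I + (\<Sum>C\<in>Pow I - {{}}. ?n C * Y E A (I - C))"
    using prod_Y_singletons[OF assms(1) psubset.hyps(1), of A] psubset.hyps(1)
    by (simp add: sum.remove[of "Pow I" "{}"] derangements_on_empty)
  then have eq: "Y E A I - Y_mon E A (mset_set I) = - (\<Sum>C\<in>Pow I - {{}}. ?n C * Y E A (I - C))"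
    by (simp add: Y_mon_mset_set)
  have "Y E A (I - C) \<in> ?S I" if "C \<in> Pow I - {{}}" for C
  proof -
    have less: "mset_set (I - C) \<subset># mset_set I"
      using that psubset.hyps by (auto simp: subset_mset.less_le subset_imp_msubset_mset_set)
    then have "?S (I - C) \<subseteq> ?S I"
      by (intro laurent.span_mono image_mono) auto
    then have "Y E A (I - C) - Y_mon E A (mset_set (I - C)) \<in> ?S I"
      using psubset.IH[of "I - C"] that by blast
    moreover have "Y_mon E A (mset_set (I - C)) \<in> ?S I"
      using less by (intro laurent.span_base) blast
    ultimately show ?thesis
      using laurent.span_add by fastforce
  qed
  then show ?case
    unfolding eq by (intro laurent.span_neg laurent.span_sum span_of_nat_mult) blast
qed

text \<open>Induction on \<open>Q\<close> with
  \<open>p * q - m * n = (p - m) * q + m * (q - n)\<close>: in each summand one factor is strictly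
  smaller than its leading monomial.\<close>

lemma prod_Y_unitriangular:
  assumes "finite E" "\<And>I. I \<in># Q \<Longrightarrow> finite I"
  shows "(\<Prod>I\<in>#Q. Y E A I) - Y_mon E A (content Q)
    \<in> laurent.span (Y_mon E A ` {b. b \<subset># content Q})"
  using assms(2)
proof (induction Q)
  case empty
  then show ?case by (simp add: laurent.span_zero)
next
  case (add I Q)
  let ?p = "Y E A I" and ?q = "\<Prod>I\<in>#Q. Y E A I"
  let ?m = "Y_mon E A (mset_set I)" and ?n = "Y_mon E A (content Q)"
  let ?U = "laurent.span (Y_mon E A ` {b. b \<subset># content (add_mset I Q)})"
  have p: "?p - ?m \<in> laurent.span (Y_mon E A ` {b. b \<subset># mset_set I})"
    by (rule Y_unitriangular[OF assms(1)]) (simp add: add.prems)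
  have q: "?q - ?n \<in> laurent.span (Y_mon E A ` {b. b \<subset># content Q})"
    using add by simp
  \<comment> \<open>In \<open>(?p - ?m) * ?q\<close> strictness comes from the first factor, so
    \<open>?q\<close> is bounded by \<open>\<subseteq>#\<close> only.\<close>
  then have "?q - ?n \<in> laurent.span (Y_mon E A ` {b. b \<subseteq># content Q})"
    by (rule rev_subsetD) (auto intro!: laurent.span_mono)
  moreover have "?n \<in> laurent.span (Y_mon E A ` {b. b \<subseteq># content Q})"
    by (intro laurent.span_base) auto
  ultimately have "(?q - ?n) + ?n \<in> laurent.span (Y_mon E A ` {b. b \<subseteq># content Q})"
    by (rule laurent.span_add)
  then have "?q \<in> laurent.span (Y_mon E A ` {b. b \<subseteq># content Q})"
    by simp
  with p have "(?p - ?m) * ?q \<in> ?U"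
  proof (rule span_mult, clarsimp)
    fix b b' assume "b \<subset># mset_set I" "b' \<subseteq># content Q"
    then have "b + b' \<subset># mset_set I + content Q"
      by (rule subset_mset.add_less_le_mono)
    then show "Y_mon E A b * Y_mon E A b' \<in> laurent.span (Y_mon E A ` {b. b \<subset># mset_set I + content Q})"
      by (intro laurent.span_base) (metis Y_mon_simps(3) imageI mem_Collect_eq)
  qed
  moreover have "?m * (?q - ?n) \<in> ?U"
  proof (rule span_mult[OF laurent.span_base q], rule singletonI, clarsimp)
    fix b' assume "b' \<subset># content Q"
    then have "mset_set I + b' \<subset># mset_set I + content Q"
      by simp
    then show "?m * Y_mon E A b' \<in> laurent.span (Y_mon E A ` {b. b \<subset># mset_set I + content Q})"
      by (intro laurent.span_base) (metis Y_mon_simps(3) imageI mem_Collect_eq)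
  qed
  ultimately have "(?p - ?m) * ?q + ?m * (?q - ?n) \<in> ?U"
    by (rule laurent.span_add)
  then show ?case
    by (simp add: algebra_simps)
qed

text \<open>The exchange relation: \<open>X v\<close> cancels the denominator of
  \<open>Y E A {v}\<close>. It removes a vertex common to both exponents, and it also exposes the
  lowest term of \<open>Y E A {v}\<close>.\<close>

lemma X_mult_Y_singleton:
  assumes "finite E"
  shows "X v * Y E A {v} = const (A v) + (\<Sum>w | (v, w) \<in> E \<and> w \<noteq> v. X w)"
proof -
  have fin: "finite {w. w = v \<or> (v, w) \<in> E}"
    by (rule finite_functions_on_choices) (use assms in simp)
  have "X v * Y E A {v} = (\<Sum>w | w = v \<or> (v, w) \<in> E. X_tilde A v w * (X v * X_inv v))"
    by (simp add: Y_singleton_sum[OF assms] sum_distrib_left mult.left_commute)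
  also have "\<dots> = (\<Sum>w | w = v \<or> (v, w) \<in> E. X_tilde A v w)"
    by (simp add: X_mult_X_inv)
  also have "\<dots> = X_tilde A v v + (\<Sum>w\<in>{w. w = v \<or> (v, w) \<in> E} - {v}. X_tilde A v w)"
    using fin by (subst sum.remove[of _ v]) auto
  also have "{w. w = v \<or> (v, w) \<in> E} - {v} = {w. (v, w) \<in> E \<and> w \<noteq> v}"
    by blast
  also have "X_tilde A v v + (\<Sum>w | (v, w) \<in> E \<and> w \<noteq> v. X_tilde A v w) =
      const (A v) + (\<Sum>w | (v, w) \<in> E \<and> w \<noteq> v. X w)"
    by (simp add: X_tilde_def)
  finally show ?thesis .
qed

section \<open>Cluster monomials as pairs of a vertex multiset and a nested multicollection\<close>

lemma cluster_monomialI: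
  assumes "finite V" "set_mset a \<subseteq> V" "nested_collection E (V - set_mset a) (set_mset Q)"
  shows "X_mon a * (\<Prod>I\<in>#Q. Y E A I) \<in> cluster_monomials V E A"
proof -
  let ?M = "image_mset X a + image_mset (Y E A) Q"
  have mono: "\<Prod>\<^sub># M \<in> cluster_monomials V E A" if "C \<in> clusters V E A" "set_mset M \<subseteq> C" for M C
    using that unfolding cluster_monomials_def by blast
  obtain N where N: "maximal_nested_collection E (V - set_mset a) N" "set_mset Q \<subseteq> N"
    by (rule maximal_nested_collection_extends[OF finite_Diff[OF assms(1)] assms(3)])
  then have "X ` set_mset a \<union> Y E A ` N \<in> clusters V E A"
    using assms(2) unfolding clusters_def by blast
  moreover have "set_mset ?M \<subseteq> X ` set_mset a \<union> Y E A ` N"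
    using N(2) by auto
  ultimately have "\<Prod>\<^sub># ?M \<in> cluster_monomials V E A"
    by (rule mono)
  then show ?thesis
    by (simp add: X_mon_def)
qed

lemma cluster_monomialE:
  assumes "p \<in> cluster_monomials V E A"
  obtains a Q where "p = X_mon a * (\<Prod>I\<in>#Q. Y E A I)" "set_mset a \<subseteq> V"
    "nested_collection E (V - set_mset a) (set_mset Q)"
proof -
  from assms obtain M C where p: "p = \<Prod>\<^sub># M" and C: "C \<in> clusters V E A" "set_mset M \<subseteq> C"
    unfolding cluster_monomials_def by blast
  from C(1) obtain U N where UN: "C = X ` U \<union> Y E A ` N" "U \<subseteq> V" "maximal_nested_collection E (V - U) N"
    unfolding clusters_def by blast
  from UN(3) have N: "nested_collection E (V - U) N"
    by (simp add: maximal_nested_collection_def)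
  \<comment> \<open>The factors of \<open>M\<close> are sorted into those of the form
    \<open>X v\<close> and those of the form \<open>Y E A I\<close>. Uniqueness of \<open>a\<close>
    and \<open>Q\<close> is not claimed here.\<close>
  have "\<exists>a Q. set_mset a \<subseteq> U \<and> set_mset Q \<subseteq> N \<and> \<Prod>\<^sub># M = X_mon a * (\<Prod>I\<in>#Q. Y E A I)"
    using C(2)
  proof (induction M)
    case empty
    show ?case by (intro exI[of _ "{#}"]) simp
  next
    case (add x M)
    then obtain a Q where aQ: "set_mset a \<subseteq> U" "set_mset Q \<subseteq> N"
      "\<Prod>\<^sub># M = X_mon a * (\<Prod>I\<in>#Q. Y E A I)" by auto
    from add.prems consider v where "v \<in> U" "x = X v" | I where "I \<in> N" "x = Y E A I"
      by (auto simp: UN(1))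
    then show ?case
    proof cases
      case 1
      then show ?thesis
        using aQ by (intro exI[of _ "add_mset v a"] exI[of _ Q]) (simp add: mult.assoc)
    next
      case 2
      then show ?thesis
        using aQ by (intro exI[of _ a] exI[of _ "add_mset I Q"]) (simp add: mult.left_commute)
    qed
  qed
  then obtain a Q where aQ: "set_mset a \<subseteq> U" "set_mset Q \<subseteq> N" "\<Prod>\<^sub># M = X_mon a * (\<Prod>I\<in>#Q. Y E A I)"
    by (elim exE conjE)
  show thesis
  proof (rule that)
    show "p = X_mon a * (\<Prod>I\<in>#Q. Y E A I)"
      using p aQ(3) by (rule trans)
    show "set_mset a \<subseteq> V"
      using aQ(1) UN(2) by (rule subset_trans)
    show "nested_collection E (V - set_mset a) (set_mset Q)"
      using N aQ(2) by (rule nested_collection_subset) (use aQ(1) in auto)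
  qed
qed

text \<open>Induction on the size of \<open>b\<close> for all \<open>a\<close> at once, because the
  exchange relation shortens \<open>b\<close> but changes \<open>a\<close>. If the supports are
  disjoint, the monomial differs from a cluster monomial by terms with the same \<open>a\<close> and
  smaller \<open>b\<close>.\<close>

lemma X_mon_Y_mon_in_span_cluster_monomials:
  assumes "finite V" "E \<subseteq> V \<times> V" "set_mset a \<subseteq> V" "set_mset b \<subseteq> V"
  shows "X_mon a * Y_mon E A b \<in> laurent.span (cluster_monomials V E A)"
  using assms(3,4)
proof (induction "size b" arbitrary: a b rule: less_induct)
  case less
  have finE: "finite E"
    using assms(1,2) by (meson finite_SigmaI finite_subset)
  let ?S = "laurent.span (cluster_monomials V E A)"
  show ?case
  proof (cases "set_mset a \<inter> set_mset b = {}")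
    case False
    then obtain v where "v \<in># a" "v \<in># b"
      by auto
    then obtain a' b' where ab: "a = add_mset v a'" "b = add_mset v b'"
      by (elim mset_add)
    have "X_mon a * Y_mon E A b = (X v * Y E A {v}) * (X_mon a' * Y_mon E A b')"
      by (simp add: ab mult_ac)
    also have "\<dots> = scale (A v) (X_mon a' * Y_mon E A b') +
        (\<Sum>w | (v, w) \<in> E \<and> w \<noteq> v. X_mon (add_mset w a') * Y_mon E A b')"
      by (simp add: X_mult_Y_singleton[OF finE] distrib_right sum_distrib_right scale_def mult.assoc)
    also have "\<dots> \<in> ?S"
      using less.prems ab assms(2)
      by (intro laurent.span_add laurent.span_scale laurent.span_sum less.hyps) auto
    finally show ?thesis .
  next
    case True
    from nested_multicollection_exists[of E b]
    obtain Q where Q: "nested_collection E (set_mset b) (set_mset Q)" "content Q = b"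
      by (elim exE conjE)
    let ?q = "\<Prod>I\<in>#Q. Y E A I"
    have "nested_collection E (V - set_mset a) (set_mset Q)"
      by (rule nested_collection_subset[OF Q(1) subset_refl]) (use less.prems True in auto)
    then have "X_mon a * ?q \<in> cluster_monomials V E A"
      by (rule cluster_monomialI[OF assms(1) less.prems(1)])
    moreover have "finite I" if "I \<in># Q" for I
      using nested_collection_member(1)[OF Q(1) that] by (rule finite_subset) simp
    with finE have "?q - Y_mon E A (content Q) \<in> laurent.span (Y_mon E A ` {b'. b' \<subset># content Q})"
      by (rule prod_Y_unitriangular)
    then have "?q - Y_mon E A b \<in> laurent.span (Y_mon E A ` {b'. b' \<subset># b})"
      unfolding Q(2) .
    then have "X_mon a * (?q - Y_mon E A b) \<in> ?S"
    proof (rule span_mult[OF laurent.span_base, OF singletonI], clarsimp)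
      fix b' assume "b' \<subset># b"
      then show "X_mon a * Y_mon E A b' \<in> ?S"
        using less.prems mset_subset_size set_mset_mono[of b' b]
        by (intro less.hyps) (auto simp: subset_mset.less_le)
    qed
    ultimately have "X_mon a * ?q - X_mon a * (?q - Y_mon E A b) \<in> ?S"
      by (rule laurent.span_diff[OF laurent.span_base])
    then show ?thesis
      by (simp add: right_diff_distrib)
  qed
qed

lemma subalgebra_hull: "subalgebra (subalgebra hull S)"
  by (rule hull_in) (auto simp: subalgebra_def laurent.subspace_def)

text \<open>Cluster monomials are products of generators, since members of nested collections are
  strongly connected. Conversely, all products \<open>X_mon a * Y_mon E A b\<close> span a
  subalgebra containing the generators, and each product reduces to cluster monomials.\<close>

lemma span_cluster_monomials:
  assumes "finite V" "E \<subseteq> V \<times> V"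
  shows "laurent.span (cluster_monomials V E A) = graph_LP_algebra V E A"
proof
  let ?G = "X ` V \<union> Y E A ` {I. I \<subseteq> V \<and> strongly_connected E I}"
  have alg: "subalgebra (graph_LP_algebra V E A)"
    unfolding graph_LP_algebra_def by (rule subalgebra_hull)
  have mult: "\<Prod>\<^sub># M \<in> graph_LP_algebra V E A" if "set_mset M \<subseteq> graph_LP_algebra V E A" for M
    using that alg by (induction M) (auto simp: subalgebra_def)
  have gen: "?G \<subseteq> graph_LP_algebra V E A"
    unfolding graph_LP_algebra_def by (rule hull_subset)
  have "cluster_monomials V E A \<subseteq> graph_LP_algebra V E A"
  proof
    fix p assume "p \<in> cluster_monomials V E A"
    then obtain a Q where p: "p = X_mon a * (\<Prod>I\<in>#Q. Y E A I)" and a: "set_mset a \<subseteq> V"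
      and Q: "nested_collection E (V - set_mset a) (set_mset Q)"
      by (rule cluster_monomialE)
    have "I \<subseteq> V" "strongly_connected E I" if "I \<in># Q" for I
      using nested_collection_member(1)[OF Q that] nested_collection_strongly_connected[OF Q that] by auto
    then have "set_mset (image_mset X a + image_mset (Y E A) Q) \<subseteq> ?G"
      using a by auto
    then have "\<Prod>\<^sub># (image_mset X a + image_mset (Y E A) Q) \<in> graph_LP_algebra V E A"
      using gen by (intro mult) (rule subset_trans)
    then show "p \<in> graph_LP_algebra V E A"
      by (simp add: p X_mon_def)
  qed
  then show "laurent.span (cluster_monomials V E A) \<subseteq> graph_LP_algebra V E A"
    using alg by (intro laurent.span_minimal) (auto simp: subalgebra_def)
next
  \<comment> \<open>The supports of \<open>a\<close> and \<open>b\<close> may overlap here, which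
    makes \<open>?M\<close> closed under multiplication.\<close>
  let ?M = "{X_mon a * Y_mon E A b | a b. set_mset a \<subseteq> V \<and> set_mset b \<subseteq> V}"
  have finE: "finite E"
    using assms by (meson finite_SigmaI finite_subset)
  have M: "X_mon a * Y_mon E A b \<in> laurent.span ?M" if "set_mset a \<subseteq> V" "set_mset b \<subseteq> V" for a b
    using that by (intro laurent.span_base) blast
  have "subalgebra (laurent.span ?M)"
    unfolding subalgebra_def
  proof (intro conjI ballI)
    show "1 \<in> laurent.span ?M"
      using M[of "{#}" "{#}"] by simp
    fix p q assume "p \<in> laurent.span ?M" "q \<in> laurent.span ?M"
    then show "p * q \<in> laurent.span ?M"
    proof (rule span_mult, clarsimp)
      fix a b a' b' assume "set_mset a \<subseteq> V" "set_mset b \<subseteq> V" "set_mset a' \<subseteq> V" "set_mset b' \<subseteq> V"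
      then have "X_mon (a + a') * Y_mon E A (b + b') \<in> laurent.span ?M"
        by (intro M) auto
      then show "X_mon a * Y_mon E A b * (X_mon a' * Y_mon E A b') \<in> laurent.span ?M"
        by (simp add: mult_ac)
    qed
  qed simp
  moreover have "X v \<in> laurent.span ?M" if "v \<in> V" for v
    using M[of "{#v#}" "{#}"] that by simp
  moreover have "Y E A I \<in> laurent.span ?M" if "I \<subseteq> V" for I
  proof -
    have fin: "finite I"
      using that assms(1) by (rule finite_subset)
    have Y: "Y_mon E A b \<in> laurent.span ?M" if "b \<subseteq># mset_set I" for b
      using M[of "{#}" b] set_mset_mono[OF that] fin \<open>I \<subseteq> V\<close> by simp
    then have "laurent.span (Y_mon E A ` {b. b \<subset># mset_set I}) \<subseteq> laurent.span ?M"
      by (intro laurent.span_minimal) (auto simp: subset_mset.less_le)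
    then have "Y E A I - Y_mon E A (mset_set I) \<in> laurent.span ?M"
      using Y_unitriangular[OF finE fin] by blast
    then show ?thesis
      using laurent.span_add Y[of "mset_set I"] by fastforce
  qed
  ultimately have "graph_LP_algebra V E A \<subseteq> laurent.span ?M"
    unfolding graph_LP_algebra_def by (intro hull_minimal) auto
  also have "laurent.span ?M \<subseteq> laurent.span (cluster_monomials V E A)"
    using X_mon_Y_mon_in_span_cluster_monomials[OF assms] by (intro laurent.span_minimal) auto
  finally show "graph_LP_algebra V E A \<subseteq> laurent.span (cluster_monomials V E A)" .
qed

subsection \<open>Lowest terms and independence\<close>

definition total_degree :: "'v set \<Rightarrow> ('v \<Rightarrow>\<^sub>0 int) \<Rightarrow> int" where
  "total_degree V m = (\<Sum>v\<in>V. Poly_Mapping.lookup m v)"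

lemma total_degree_zero [simp]: "total_degree V 0 = 0"
  by (simp add: total_degree_def)

lemma total_degree_add [simp]: "total_degree V (m + n) = total_degree V m + total_degree V n"
  by (simp add: total_degree_def lookup_add sum.distrib)

lemma total_degree_single [simp]:
  "finite V \<Longrightarrow> v \<in> V \<Longrightarrow> total_degree V (Poly_Mapping.single v k) = k"
  by (simp add: total_degree_def lookup_single when_def)

definition degree_gt :: "'v set \<Rightarrow> int \<Rightarrow> ('v, 'r::comm_ring_1) laurent set" where
  "degree_gt V d = {p. \<forall>m\<in>Poly_Mapping.keys p. d < total_degree V m}"

text \<open>Stated through a difference, so \<open>c = 0\<close> is allowed and lowest terms
  multiply even when coefficients are zero divisors.\<close>

definition has_lowest_term ::
  "'v set \<Rightarrow> ('v \<Rightarrow>\<^sub>0 int) \<Rightarrow> 'r \<Rightarrow> ('v, 'r::comm_ring_1) laurent \<Rightarrow> bool" where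
  "has_lowest_term V e c p \<longleftrightarrow> p - Poly_Mapping.single e c \<in> degree_gt V (total_degree V e)"

lemma degree_gt_mult:
  assumes "p \<in> degree_gt V d" "\<And>m. m \<in> Poly_Mapping.keys q \<Longrightarrow> d' \<le> total_degree V m"
  shows "p * q \<in> degree_gt V (d + d')"
  using keys_mult[of p q] assms unfolding degree_gt_def by fastforce

lemma subspace_degree_gt: "laurent.subspace (degree_gt V d)"
proof (rule laurent.subspaceI)
  show "0 \<in> degree_gt V d"
    by (simp add: degree_gt_def)
  show "p + q \<in> degree_gt V d" if "p \<in> degree_gt V d" "q \<in> degree_gt V d" for p q
    using that keys_add[of p q] unfolding degree_gt_def by blast
  show "scale c p \<in> degree_gt V d" if "p \<in> degree_gt V d" for c p
  proof -
    have "p * const c \<in> degree_gt V (d + 0)"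
      using that by (rule degree_gt_mult) (simp add: const_def split: if_splits)
    then show ?thesis
      by (simp add: scale_def mult.commute)
  qed
qed

lemma has_lowest_term_single: "has_lowest_term V e c (Poly_Mapping.single e c)"
  by (simp add: has_lowest_term_def degree_gt_def)

lemma has_lowest_term_add:
  assumes "has_lowest_term V e c p" "q \<in> degree_gt V (total_degree V e)"
  shows "has_lowest_term V e c (p + q)"
  using laurent.subspace_add[OF subspace_degree_gt assms[unfolded has_lowest_term_def]]
  by (simp add: has_lowest_term_def algebra_simps)

lemma has_lowest_term_keys:
  assumes "has_lowest_term V e c p" "m \<in> Poly_Mapping.keys p"
  shows "total_degree V e \<le> total_degree V m"
proof -
  have "Poly_Mapping.keys p \<subseteq>
      Poly_Mapping.keys (p - Poly_Mapping.single e c) \<union> Poly_Mapping.keys (Poly_Mapping.single e c)"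
    using keys_add[of "p - Poly_Mapping.single e c" "Poly_Mapping.single e c"] by simp
  then show ?thesis
    using assms unfolding has_lowest_term_def degree_gt_def by (fastforce split: if_splits)
qed

lemma has_lowest_term_mult:
  assumes "has_lowest_term V e c p" "has_lowest_term V f d q"
  shows "has_lowest_term V (e + f) (c * d) (p * q)"
proof -
  let ?s = "Poly_Mapping.single e c" and ?t = "Poly_Mapping.single f d"
  have "(p - ?s) * q \<in> degree_gt V (total_degree V e + total_degree V f)"
    using assms(1) has_lowest_term_keys[OF assms(2)]
    unfolding has_lowest_term_def by (rule degree_gt_mult)
  moreover have "(q - ?t) * ?s \<in> degree_gt V (total_degree V f + total_degree V e)"
    using assms(2) has_lowest_term_keys[OF has_lowest_term_single]
    unfolding has_lowest_term_def by (rule degree_gt_mult)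
  \<comment> \<open>With \<open>s\<close> and \<open>t\<close> the two lowest terms,
    \<open>p * q - s * t = (p - s) * q + (q - t) * s\<close>.\<close>
  ultimately have "(p - ?s) * q + (q - ?t) * ?s \<in> degree_gt V (total_degree V (e + f))"
    by (intro laurent.subspace_add[OF subspace_degree_gt]) (simp_all add: add.commute)
  also have "(p - ?s) * q + (q - ?t) * ?s = p * q - Poly_Mapping.single (e + f) (c * d)"
    by (simp add: algebra_simps mult_single)
  finally show ?thesis
    by (simp add: has_lowest_term_def)
qed

lemma has_lowest_term_prod_mset:
  assumes "\<And>v. v \<in># b \<Longrightarrow> has_lowest_term V (e v) (c v) (p v)"
  shows "has_lowest_term V (\<Sum>v\<in>#b. e v) (\<Prod>v\<in>#b. c v) (\<Prod>v\<in>#b. p v)"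
  using assms
proof (induction b)
  case empty
  then show ?case
    using has_lowest_term_single[of V 0 1] by simp
qed (simp add: has_lowest_term_mult)

text \<open>The remainder lives in degrees above that of \<open>e\<close>, so up to this degree
  \<open>p\<close> agrees with its lowest term.\<close>

lemma lookup_lowest_term:
  assumes "has_lowest_term V e c p" "total_degree V m \<le> total_degree V e"
  shows "Poly_Mapping.lookup p m = (c when m = e)"
proof -
  have "m \<notin> Poly_Mapping.keys (p - Poly_Mapping.single e c)"
    using assms unfolding has_lowest_term_def degree_gt_def by fastforce
  then have "Poly_Mapping.lookup p m = Poly_Mapping.lookup (Poly_Mapping.single e c) m"
    by (simp add: in_keys_iff lookup_minus)
  then show ?thesis
    by (auto simp: lookup_single when_def)
qed

lemma lookup_scale: "Poly_Mapping.lookup (scale c p) m = c * Poly_Mapping.lookup p m"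
  by (simp add: scale_def const_def Poly_Mapping.map.rep_eq when_def flip: mult_map_scale_conv_mult)

text \<open>In a nontrivial relation take \<open>p\<close> of least degree among the elements with
  nonzero coefficient. All others have degree at least as large and a different exponent, so the
  coefficient of the relation at \<open>e p\<close> is \<open>u p * c p\<close>.\<close>

lemma independent_of_lowest_terms:
  assumes low: "\<And>p. p \<in> S \<Longrightarrow> has_lowest_term V (e p) (c p) p"
    and inj: "inj_on e S" and nzd: "\<And>p d. p \<in> S \<Longrightarrow> d * c p = 0 \<Longrightarrow> d = 0"
  shows "laurent.independent S"
  unfolding laurent.independent_explicit_module
proof (intro allI impI, rule ccontr)
  fix t u q assume t: "finite t" "t \<subseteq> S" "(\<Sum>p\<in>t. scale (u p) p) = 0" "q \<in> t" "u q \<noteq> 0"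
  let ?T = "{p \<in> t. u p \<noteq> 0}"
  define p where "p = arg_min_on (\<lambda>p. total_degree V (e p)) ?T"
  have T: "finite ?T" "?T \<noteq> {}"
    using t by auto
  have p: "p \<in> ?T"
    unfolding p_def by (rule arg_min_if_finite(1)[OF T])
  have p_min: "total_degree V (e p) \<le> total_degree V (e q)" if "q \<in> ?T" for q
    unfolding p_def by (rule arg_min_least[OF T that])
  have "0 = Poly_Mapping.lookup (\<Sum>q\<in>t. scale (u q) q) (e p)"
    using t(3) by simp
  also have "\<dots> = (\<Sum>q\<in>t. u q * Poly_Mapping.lookup q (e p))"
    by (simp add: lookup_sum lookup_scale)
  also have "\<dots> = (\<Sum>q\<in>t. if q = p then u p * c p else 0)"
  proof (rule sum.cong[OF refl])
    fix q assume q: "q \<in> t"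
    show "u q * Poly_Mapping.lookup q (e p) = (if q = p then u p * c p else 0)"
    proof (cases "u q = 0")
      case True
      then show ?thesis using p by auto
    next
      case False
      then have "Poly_Mapping.lookup q (e p) = (c q when e p = e q)"
        using q t(2) by (intro lookup_lowest_term[OF low] p_min) auto
      moreover have "e p = e q \<longleftrightarrow> q = p"
        using inj_on_eq_iff[OF inj, of p q] p q t(2) by auto
      ultimately show ?thesis by (simp add: when_def)
    qed
  qed
  also have "\<dots> = u p * c p"
    using t(1) p by simp
  finally show False
    using nzd[of p "u p"] p t(2) by auto
qed

section \<open>Lowest terms of cluster monomials\<close>

lemma has_lowest_term_X: "has_lowest_term V (Poly_Mapping.single v 1) 1 (X v)"
  unfolding X_def by (rule has_lowest_term_single)

lemma has_lowest_term_Y_singleton: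
  fixes A :: "'v \<Rightarrow> 'r::comm_ring_1"
  assumes "finite V" "E \<subseteq> V \<times> V" "v \<in> V"
  shows "has_lowest_term V (Poly_Mapping.single v (- 1)) (A v) (Y E A {v})"
proof -
  have finE: "finite E"
    using assms by (meson finite_SigmaI finite_subset)
  \<comment> \<open>Inserting \<open>X v * X_inv v\<close> brings in the exchange relation: the term
    with \<open>A v\<close> has degree -1, every \<open>X_inv v * X w\<close> has degree 0.\<close>
  have "Y E A {v} = (X v * X_inv v) * Y E A {v}"
    by (simp add: X_mult_X_inv)
  also have "\<dots> = X_inv v * (X v * Y E A {v})"
    by (simp only: mult_ac)
  also have "\<dots> = Poly_Mapping.single (Poly_Mapping.single v (- 1)) (A v) +
      (\<Sum>w | (v, w) \<in> E \<and> w \<noteq> v. X_inv v * X w)"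
    by (simp add: X_mult_Y_singleton[OF finE] distrib_left sum_distrib_left)
      (simp add: X_inv_def const_def mult_single)
  finally have eq: "Y E A {v} = \<dots>" .
  have "(X_inv v * X w :: ('v, 'r) laurent) \<in> degree_gt V (- 1)" if "(v, w) \<in> E" for w
  proof -
    have "total_degree V (Poly_Mapping.single v (- 1) + Poly_Mapping.single w 1) = 0"
      using that assms by (subst total_degree_add) auto
    then show ?thesis
      by (simp add: X_inv_def X_def mult_single degree_gt_def)
  qed
  then show ?thesis
    unfolding eq using assms
    by (intro has_lowest_term_add has_lowest_term_single laurent.subspace_sum[OF subspace_degree_gt]) simp
qed

text \<open>The integer vector \<open>a - b\<close>, written as sums over multisets to match
  \<open>has_lowest_term_prod_mset\<close>.\<close>

definition exponent :: "'v multiset \<Rightarrow> 'v multiset \<Rightarrow> 'v \<Rightarrow>\<^sub>0 int" where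
  "exponent a b = (\<Sum>v\<in>#a. Poly_Mapping.single v 1) + (\<Sum>v\<in>#b. Poly_Mapping.single v (- 1))"

lemma lookup_exponent: "Poly_Mapping.lookup (exponent a b) v = int (count a v) - int (count b v)"
proof -
  have "Poly_Mapping.lookup (\<Sum>w\<in>#c. Poly_Mapping.single w k) v = k * int (count c v)" for k c
    by (induction c) (simp_all add: lookup_add lookup_single when_def algebra_simps)
  then show ?thesis
    by (simp add: exponent_def lookup_add)
qed

lemma total_degree_exponent:
  assumes "finite V" "set_mset a \<subseteq> V" "set_mset b \<subseteq> V"
  shows "total_degree V (exponent a b) = int (size a) - int (size b)"
proof -
  have "total_degree V (\<Sum>w\<in>#c. Poly_Mapping.single w k) = k * int (size c)"
    if "set_mset c \<subseteq> V" for k c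
    using that by (induction c) (simp_all add: assms(1) algebra_simps)
  then show ?thesis
    using assms by (simp add: exponent_def)
qed

text \<open>With disjoint supports, \<open>a\<close> and \<open>b\<close> are the positive and
  negative parts of the exponent.\<close>

lemma exponent_eqD:
  assumes "exponent a b = exponent a' b'" "set_mset a \<inter> set_mset b = {}" "set_mset a' \<inter> set_mset b' = {}"
  shows "a = a' \<and> b = b'"
proof -
  have "count a v = count a' v \<and> count b v = count b' v" for v
  proof -
    have "int (count a v) - int (count b v) = int (count a' v) - int (count b' v)"
      using assms(1) by (metis lookup_exponent)
    moreover have "count a v = 0 \<or> count b v = 0" "count a' v = 0 \<or> count b' v = 0"
      using assms(2,3) by (auto simp: count_eq_zero_iff)
    ultimately show ?thesis by linarith
  qed
  then show ?thesis by (simp add: multiset_eq_iff)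
qed

lemma has_lowest_term_X_mon_Y_mon:
  assumes "finite V" "E \<subseteq> V \<times> V" "set_mset b \<subseteq> V"
  shows "has_lowest_term V (exponent a b) (\<Prod>v\<in>#b. A v) (X_mon a * Y_mon E A b)"
proof -
  have "has_lowest_term V (\<Sum>v\<in>#a. Poly_Mapping.single v 1) (\<Prod>v\<in>#a. 1) (X_mon a)"
    unfolding X_mon_def by (intro has_lowest_term_prod_mset has_lowest_term_X)
  moreover have "has_lowest_term V (\<Sum>v\<in>#b. Poly_Mapping.single v (- 1)) (\<Prod>v\<in>#b. A v) (Y_mon E A b)"
    unfolding Y_mon_def using assms
    by (intro has_lowest_term_prod_mset has_lowest_term_Y_singleton) auto
  ultimately show ?thesis
    unfolding exponent_def using has_lowest_term_mult by fastforce
qed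

text \<open>The correction terms of \<open>prod_Y_unitriangular\<close> have a smaller
  \<open>b\<close>, hence a larger total degree \<open>size a - size b\<close>, and do not affect
  the lowest term.\<close>

lemma has_lowest_term_cluster_monomial:
  assumes "finite V" "E \<subseteq> V \<times> V" "set_mset a \<subseteq> V" "\<And>I. I \<in># Q \<Longrightarrow> I \<subseteq> V"
  shows "has_lowest_term V (exponent a (content Q)) (\<Prod>v\<in>#content Q. A v)
    (X_mon a * (\<Prod>I\<in>#Q. Y E A I))"
proof -
  let ?q = "\<Prod>I\<in>#Q. Y E A I" and ?b = "content Q"
  have finE: "finite E"
    using assms by (meson finite_SigmaI finite_subset)
  have fin: "finite I" if "I \<in># Q" for I
    using finite_subset[OF assms(4)[OF that] assms(1)] .
  have b: "set_mset ?b \<subseteq> V"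
    using set_mset_content[OF fin] assms(4) by blast
  have "?q - Y_mon E A ?b \<in> laurent.span (Y_mon E A ` {b. b \<subset># ?b})"
    using finE fin by (rule prod_Y_unitriangular)
  then have "X_mon a * (?q - Y_mon E A ?b) \<in> laurent.span (degree_gt V (total_degree V (exponent a ?b)))"
  proof (rule span_mult[OF laurent.span_base, OF singletonI], clarsimp)
    fix b assume b': "b \<subset># ?b"
    then have bV: "set_mset b \<subseteq> V"
      using b set_mset_mono[of b ?b] by (auto simp: subset_mset.less_le)
    have "total_degree V (exponent a ?b) < total_degree V (exponent a b)"
      using mset_subset_size[OF b'] assms(1,3) b bV by (simp add: total_degree_exponent)
    then have "X_mon a * Y_mon E A b \<in> degree_gt V (total_degree V (exponent a ?b))"
      using has_lowest_term_keys[OF has_lowest_term_X_mon_Y_mon[OF assms(1,2) bV, of a A]]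
      unfolding degree_gt_def by fastforce
    then show "X_mon a * Y_mon E A b \<in> laurent.span (degree_gt V (total_degree V (exponent a ?b)))"
      by (rule laurent.span_base)
  qed
  then have "X_mon a * (?q - Y_mon E A ?b) \<in> degree_gt V (total_degree V (exponent a ?b))"
    by (simp add: laurent.span_eq_iff[THEN iffD2, OF subspace_degree_gt])
  then have "has_lowest_term V (exponent a ?b) (\<Prod>v\<in>#?b. A v)
      (X_mon a * Y_mon E A ?b + X_mon a * (?q - Y_mon E A ?b))"
    by (intro has_lowest_term_add has_lowest_term_X_mon_Y_mon assms b)
  then show ?thesis
    by (simp add: algebra_simps)
qed

lemma independent_cluster_monomials:
  fixes A :: "'v \<Rightarrow> 'r::comm_ring_1"
  assumes "finite V" "E \<subseteq> V \<times> V" and nzd: "\<forall>v\<in>V. \<forall>c. c * A v = 0 \<longrightarrow> c = 0"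
  shows "laurent.independent (cluster_monomials V E A)"
proof -
  let ?C = "cluster_monomials V E A"
  have "\<exists>aQ. p = X_mon (fst aQ) * (\<Prod>I\<in>#snd aQ. Y E A I) \<and> set_mset (fst aQ) \<subseteq> V \<and>
      nested_collection E (V - set_mset (fst aQ)) (set_mset (snd aQ))" if "p \<in> ?C" for p
    using that
  proof (rule cluster_monomialE)
    fix a Q assume "p = X_mon a * (\<Prod>I\<in>#Q. Y E A I)" "set_mset a \<subseteq> V"
      "nested_collection E (V - set_mset a) (set_mset Q)"
    then show ?thesis
      by (intro exI[of _ "(a, Q)"]) simp
  qed
  then obtain r where r: "\<forall>p\<in>?C. p = X_mon (fst (r p)) * (\<Prod>I\<in>#snd (r p). Y E A I) \<and>
      set_mset (fst (r p)) \<subseteq> V \<and>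
      nested_collection E (V - set_mset (fst (r p))) (set_mset (snd (r p)))"
    by metis
  \<comment> \<open>A pair \<open>(a p, Q p)\<close> is chosen once for each cluster monomial, so
    that exponents become a function of \<open>p\<close>.\<close>
  define a Q where "a = fst \<circ> r" and "Q = snd \<circ> r"
  have p: "p = X_mon (a p) * (\<Prod>I\<in>#Q p. Y E A I)" "set_mset (a p) \<subseteq> V"
    "nested_collection E (V - set_mset (a p)) (set_mset (Q p))" if "p \<in> ?C" for p
    using bspec[OF r that] unfolding a_def Q_def comp_apply by blast+
  have QV: "I \<subseteq> V - set_mset (a p)" if "p \<in> cluster_monomials V E A" "I \<in># Q p" for p I
    using nested_collection_member(1)[OF p(3)[OF that(1)] that(2)] .
  have content: "set_mset (content (Q p)) = \<Union>(set_mset (Q p))" if "p \<in> cluster_monomials V E A" for p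
    using QV[OF that] assms(1) by (intro set_mset_content) (meson finite_Diff finite_subset)
  show ?thesis
  proof (rule independent_of_lowest_terms)
    fix p assume pC: "p \<in> cluster_monomials V E A"
    have "has_lowest_term V (exponent (a p) (content (Q p))) (\<Prod>v\<in>#content (Q p). A v)
        (X_mon (a p) * (\<Prod>I\<in>#Q p. Y E A I))"
      using p(2)[OF pC] QV[OF pC] assms(1,2) by (intro has_lowest_term_cluster_monomial) auto
    then show "has_lowest_term V (exponent (a p) (content (Q p))) (\<Prod>v\<in>#content (Q p). A v) p"
      using p(1)[OF pC] by simp
    \<comment> \<open>A product of elements that are not zero divisors is not a zero
      divisor.\<close>
    have "d * (\<Prod>v\<in>#b. A v) = 0 \<Longrightarrow> d = 0" if "set_mset b \<subseteq> V" for b and d :: 'r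
      using that
    proof (induction b arbitrary: d)
      case (add v b)
      then have "(d * A v) * (\<Prod>v\<in>#b. A v) = 0"
        by (simp add: mult.assoc)
      then have "d * A v = 0"
        using add by simp
      then show ?case
        using add.prems(2) nzd by auto
    qed simp
    then show "d = 0" if "d * (\<Prod>v\<in>#content (Q p). A v) = 0" for d
      using that content[OF pC] QV[OF pC] by blast
  next
    show "inj_on (\<lambda>p. exponent (a p) (content (Q p))) (cluster_monomials V E A)"
    proof (rule inj_onI)
      fix p q assume pq: "p \<in> cluster_monomials V E A" "q \<in> cluster_monomials V E A"
        and eq: "exponent (a p) (content (Q p)) = exponent (a q) (content (Q q))"
      \<comment> \<open>Members of \<open>Q p\<close> avoid the support of \<open>a p\<close>. So
        the exponent determines \<open>a p\<close> and the content, the content determines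
        \<open>Q p\<close>, and these determine \<open>p\<close>.\<close>
      have "set_mset (a p) \<inter> set_mset (content (Q p)) = {}" "set_mset (a q) \<inter> set_mset (content (Q q)) = {}"
        using content QV pq by blast+
      then have "a p = a q" "content (Q p) = content (Q q)"
        using exponent_eqD[OF eq] by blast+
      moreover have "nested_collection E V (set_mset (Q p))" if "p \<in> cluster_monomials V E A" for p
        using p(3)[OF that] by (rule nested_collection_subset) auto
      ultimately have "Q p = Q q"
        using pq by (intro nested_multicollection_eqI[OF assms(1)])
      then show "p = q"
        using \<open>a p = a q\<close> p(1) pq by metis
    qed
  qed
qed

theorem theorem1p1:
  fixes V :: "'v set" and E :: "('v \<times> 'v) set" and A :: "'v \<Rightarrow> 'r::comm_ring_1"
  assumes "finite V" and "E \<subseteq> V \<times> V"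
    and "algebraically_independent_on V A"
    and "\<forall>v\<in>V. \<forall>c. c * A v = 0 \<longrightarrow> c = 0"
  shows "laurent.independent (cluster_monomials V E A) \<and>
         laurent.span (cluster_monomials V E A) = graph_LP_algebra V E A"
  using independent_cluster_monomials[OF assms(1,2,4)] span_cluster_monomials[OF assms(1,2)] by blast

end
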